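(* Let $k>0$, $\lambda_1,\lambda_2>0$, $\lambda_3,\lambda_4<0$, $T>0$, $g_{0R},g_{0I},g_{1R},g_{1I}\in\mathbb{R}$, and let $f_R,f_I:[0,1]\to\mathbb{R}$ be sufficiently smooth. Consider the initial boundary value problem (R) and the numerical scheme (S) defined in the context. Then: (1) The scheme (S) maintains discrete steady states of (R): if $\vec r_\ast:[0,1]\to\mathbb{R}^4$ is a time-independent solution of the differential equations and boundary conditions of (R), and $\vec r_j^{\,n}=\vec r_\ast(x_j)$ for all $j=0,\dots,N_x$, then $\vec r_j^{\,n+1}=\vec r_j^{\,n}$ for all $j=0,\dots,N_x$. (2) The scheme (S) is stable under the CFL condition $\max\{\lambda_1,\lambda_2,|\lambda_3|,|\lambda_4|\}\,\Delta t/\Delta x<1$: there is a constant $C$, depending only on $T,k,\lambda_1,\dots,\lambda_4$, such that for all $N_x,N_t\in\mathbb{N}$ (positive) satisfying the CFL condition, any two grid functions $(\vec r_j^{\,n})$, $(\vec s_j^{\,n})$ satisfying the difference equations and boundary conditions of (S) with the same data $f_R,f_I,g_{0R},g_{0I},g_{1R},g_{1I}$ satisfy $\max_j|\vec r_j^{\,n}-\vec s_j^{\,n}|\le C\max_j|\vec r_j^{\,0}-\vec s_j^{\,0}|$ for all $0\le n\le N_t$. (3) The scheme (S) is consistent with (R) in the sense of local truncation error: if the values $\vec r(t_n,x_j)$ of a sufficiently smooth solution $\vec r$ of (R) on $[0,T]\times[0,1]$ are inserted into the difference equations of (S), the residual tends to $0$, uniformly over all grid points and components at which the difference equations are imposed,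 as $\Delta t,\Delta x\to 0$.
   Context: Put $\Lambda=\mathrm{diag}\{\lambda_1,\lambda_2,\lambda_3,\lambda_4\}$, $\Lambda^+=\mathrm{diag}\{\lambda_1,\lambda_2,0,0\}$, $\Lambda^-=\mathrm{diag}\{0,0,\lambda_3,\lambda_4\}$, $$M=k\begin{pmatrix}0&-1&1&1\\ 1&0&-1&1\\ 0&0&0&1\\ 0&0&-1&0\end{pmatrix},\qquad \vec\Phi=(f_R,f_I,f_R,f_I)^T.$$ Problem (R): find $\vec r=(r_1,r_2,r_3,r_4)^T$ with $$\frac{\partial\vec r}{\partial t}+\Lambda\frac{\partial\vec r}{\partial x}=\Lambda M\vec r+\Lambda\vec\Phi,\quad t>0,\ 0<x<1,\qquad \vec r(0,x)=\vec r_0(x),\ 0<x<1,$$ $$r_1(t,0)=g_{0R},\quad r_2(t,0)=g_{0I},\quad r_3(t,1)=g_{1R},\quad r_4(t,1)=g_{1I},\qquad t\ge0.$$ Scheme (S): let $\Delta x=1/N_x$, $x_j=j\Delta x$ ($j=0,\dots,N_x$), $\Delta t=T/N_t$, $t_n=n\Delta t$ ($n=0,\dots,N_t$). The grid function $\vec r_j^{\,n}=(r_{1,j}^n,\dots,r_{4,j}^n)^T\in\mathbb{R}^4$ satisfies the difference equations $$\frac{\vec r_j^{\,n+1}-\vec r_j^{\,n}}{\Delta t}+\Lambda^+\frac{\vec r_j^{\,n}-\vec r_{j-1,+}^{\,n}}{\Delta x}+\Lambda^-\frac{\vec r_{j+1,-}^{\,n}-\vec r_j^{\,n}}{\Delta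 x}=0,$$ the initial condition $\vec r_j^{\,0}=\vec r(0,x_j)$, and the boundary conditions $r_{1,0}^n=g_{0R}$, $r_{2,0}^n=g_{0I}$, $r_{3,N_x}^n=g_{1R}$, $r_{4,N_x}^n=g_{1I}$ for all $n$, where $$\vec r_{j-1,+}^{\,n}=e^{M\Delta x}\vec r_{j-1}^{\,n}+e^{M\Delta x}\int_{x_{j-1}}^{x_j}e^{-M(\xi-x_{j-1})}\vec\Phi(\xi)\,d\xi,$$ $$\vec r_{j+1,-}^{\,n}=e^{-M\Delta x}\vec r_{j+1}^{\,n}+e^{-M\Delta x}\int_{x_{j+1}}^{x_j}e^{-M(\xi-x_{j+1})}\vec\Phi(\xi)\,d\xi.$$ Components 1 and 2 of the difference equations are imposed for $1\le j\le N_x$, and components 3 and 4 for $0\le j\le N_x-1$; the remaining boundary components are given by the boundary conditions. *)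

theory Defs
  imports "HOL-Analysis.Analysis"
begin

subsection \<open>Matrices and data\<close>

(* The multiplication of the type real^'n^'n is componentwise and the type is not a
   normed algebra, so the library's power and exp are not the matrix ones. *)
definition matrix_exp :: "real^'n^'n \<Rightarrow> real^'n^'n" where
  "matrix_exp A = (\<Sum>n. (1 / fact n) *\<^sub>R ((\<lambda>B. A ** B) ^^ n) (mat 1))"

definition diag :: "real^4 \<Rightarrow> real^4^4" where
  "diag v = (\<chi> i j. if i = j then v $ i else 0)"

definition Lam :: "real^4 \<Rightarrow> real^4^4" where
  "Lam lam = diag lam"

definition Lam_plus :: "real^4 \<Rightarrow> real^4^4" where
  "Lam_plus lam = diag (vector [lam $ 1, lam $ 2, 0, 0])"

definition Lam_minus :: "real^4 \<Rightarrow> real^4^4" where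
  "Lam_minus lam = diag (vector [0, 0, lam $ 3, lam $ 4])"

definition Mmat :: "real \<Rightarrow> real^4^4" where
  "Mmat k = k *\<^sub>R vector [vector [0, -1,  1, 1],
                          vector [1,  0, -1, 1],
                          vector [0,  0,  0, 1],
                          vector [0,  0, -1, 0]]"

definition Phi :: "(real \<Rightarrow> real) \<Rightarrow> (real \<Rightarrow> real) \<Rightarrow> real \<Rightarrow> real^4" where
  "Phi fR fI x = vector [fR x, fI x, fR x, fI x]"

lemma vector_4_nth:
  "(vector [a, b, c, d] :: 'a::zero^4) $ 1 = a"
  "(vector [a, b, c, d] :: 'a::zero^4) $ 2 = b"
  "(vector [a, b, c, d] :: 'a::zero^4) $ 3 = c"
  "(vector [a, b, c, d] :: 'a::zero^4) $ 4 = d"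
  unfolding vector_def by simp_all

subsection \<open>Smoothness\<close>

(* Continuous differentiability up to the boundary, with one-sided derivatives at boundary
   points; values of the functions outside the domain play no role. *)

definition C1_unit_interval :: "(real \<Rightarrow> real) \<Rightarrow> bool" where
  "C1_unit_interval f \<longleftrightarrow>
     (\<exists>f'. continuous_on {0..1} f' \<and>
           (\<forall>x\<in>{0..1}. (f has_real_derivative f' x) (at x within {0..1})))"

definition C1_rectangle :: "real \<Rightarrow> (real \<Rightarrow> real \<Rightarrow> real^4) \<Rightarrow> bool" where
  "C1_rectangle T r \<longleftrightarrow>
     continuous_on ({0..T} \<times> {0..1}) (\<lambda>(t, x). r t x) \<and>
     (\<exists>rt rx. continuous_on ({0..T} \<times> {0..1}) (\<lambda>(t, x). rt t x) \<and>
              continuous_on ({0..T} \<times> {0..1}) (\<lambda>(t, x). rx t x) \<and>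
              (\<forall>t\<in>{0..T}. \<forall>x\<in>{0..1}.
                 ((\<lambda>s. r s x) has_vector_derivative rt t x) (at t within {0..T}) \<and>
                 (r t has_vector_derivative rx t x) (at x within {0..1})))"

subsection \<open>Problem (R), on the time interval from 0 to T\<close>

definition pde_R ::
  "real \<Rightarrow> real \<Rightarrow> real^4 \<Rightarrow> (real \<Rightarrow> real) \<Rightarrow> (real \<Rightarrow> real) \<Rightarrow> (real \<Rightarrow> real \<Rightarrow> real^4) \<Rightarrow> bool" where
  "pde_R T k lam fR fI r \<longleftrightarrow>
     (\<forall>t\<in>{0<..T}. \<forall>x\<in>{0<..<1}. \<exists>rt rx.
        ((\<lambda>s. r s x) has_vector_derivative rt) (at t within {0..T}) \<and>
        (r t has_vector_derivative rx) (at x) \<and>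
        rt + Lam lam *v rx = (Lam lam ** Mmat k) *v r t x + Lam lam *v Phi fR fI x)"

(* The first argument is the state at x = 0, the second the state at x = 1. *)
definition boundary_values ::
  "real \<Rightarrow> real \<Rightarrow> real \<Rightarrow> real \<Rightarrow> real^4 \<Rightarrow> real^4 \<Rightarrow> bool" where
  "boundary_values g0R g0I g1R g1I u v \<longleftrightarrow>
     u $ 1 = g0R \<and> u $ 2 = g0I \<and> v $ 3 = g1R \<and> v $ 4 = g1I"

definition solves_R ::
  "real \<Rightarrow> real \<Rightarrow> real^4 \<Rightarrow> (real \<Rightarrow> real) \<Rightarrow> (real \<Rightarrow> real) \<Rightarrow>
   real \<Rightarrow> real \<Rightarrow> real \<Rightarrow> real \<Rightarrow> (real \<Rightarrow> real^4) \<Rightarrow> (real \<Rightarrow> real \<Rightarrow> real^4) \<Rightarrow> bool" where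
  "solves_R T k lam fR fI g0R g0I g1R g1I r0 r \<longleftrightarrow>
     pde_R T k lam fR fI r \<and>
     (\<forall>x\<in>{0<..<1}. r 0 x = r0 x) \<and>
     (\<forall>t\<in>{0..T}. boundary_values g0R g0I g1R g1I (r t 0) (r t 1))"

(* Continuity on the closed interval ties the boundary values to the differential
   equation, which is only imposed in the interior. *)
definition steady_state_R ::
  "real \<Rightarrow> real \<Rightarrow> real^4 \<Rightarrow> (real \<Rightarrow> real) \<Rightarrow> (real \<Rightarrow> real) \<Rightarrow>
   real \<Rightarrow> real \<Rightarrow> real \<Rightarrow> real \<Rightarrow> (real \<Rightarrow> real^4) \<Rightarrow> bool" where
  "steady_state_R T k lam fR fI g0R g0I g1R g1I rs \<longleftrightarrow>
     continuous_on {0..1} rs \<and>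
     pde_R T k lam fR fI (\<lambda>t x. rs x) \<and>
     boundary_values g0R g0I g1R g1I (rs 0) (rs 1)"

subsection \<open>Scheme (S)\<close>

definition dx :: "nat \<Rightarrow> real" where
  "dx Nx = 1 / real Nx"

definition dt :: "real \<Rightarrow> nat \<Rightarrow> real" where
  "dt T Nt = T / real Nt"

definition xgrid :: "nat \<Rightarrow> nat \<Rightarrow> real" where
  "xgrid Nx j = real j * dx Nx"

definition tgrid :: "real \<Rightarrow> nat \<Rightarrow> nat \<Rightarrow> real" where
  "tgrid T Nt n = real n * dt T Nt"

(* Transport of the state u at the point a along the steady equation to the point b:
   with h = b - a, it is e^(hM) u + e^(hM) int_a^b e^(-(xi - a)M) Phi(xi) dxi.
   The integral is oriented, so b < a is allowed. *)
definition transport ::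
  "real \<Rightarrow> (real \<Rightarrow> real) \<Rightarrow> (real \<Rightarrow> real) \<Rightarrow> real \<Rightarrow> real \<Rightarrow> real^4 \<Rightarrow> real^4" where
  "transport k fR fI a b u =
     matrix_exp ((b - a) *\<^sub>R Mmat k) *v u +
     matrix_exp ((b - a) *\<^sub>R Mmat k) *v
       (LBINT xi=ereal a..ereal b. matrix_exp ((- (xi - a)) *\<^sub>R Mmat k) *v Phi fR fI xi)"

(* Left-hand side of the difference equations for the grid function r n j. In components 1, 2
   the terms with index j + 1, and in components 3, 4 those with index j - 1, are multiplied
   by 0; hence the values at j = Nx + 1 and the truncated j - 1 at j = 0 never matter where
   the equations are imposed. *)
definition residual ::
  "real \<Rightarrow> real \<Rightarrow> real^4 \<Rightarrow> (real \<Rightarrow> real) \<Rightarrow> (real \<Rightarrow> real) \<Rightarrow> nat \<Rightarrow> nat \<Rightarrow>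
   (nat \<Rightarrow> nat \<Rightarrow> real^4) \<Rightarrow> nat \<Rightarrow> nat \<Rightarrow> real^4" where
  "residual T k lam fR fI Nx Nt r n j =
     (1 / dt T Nt) *\<^sub>R (r (n + 1) j - r n j) +
     Lam_plus lam *v ((1 / dx Nx) *\<^sub>R
       (r n j - transport k fR fI (xgrid Nx (j - 1)) (xgrid Nx j) (r n (j - 1)))) +
     Lam_minus lam *v ((1 / dx Nx) *\<^sub>R
       (transport k fR fI (xgrid Nx (j + 1)) (xgrid Nx j) (r n (j + 1)) - r n j))"

definition imposed :: "nat \<Rightarrow> 4 \<Rightarrow> nat \<Rightarrow> bool" where
  "imposed Nx i j \<longleftrightarrow>
     (i \<in> {1, 2} \<and> 1 \<le> j \<and> j \<le> Nx) \<or> (i \<in> {3, 4} \<and> j < Nx)"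

definition difference_equations ::
  "real \<Rightarrow> real \<Rightarrow> real^4 \<Rightarrow> (real \<Rightarrow> real) \<Rightarrow> (real \<Rightarrow> real) \<Rightarrow> nat \<Rightarrow> nat \<Rightarrow>
   (nat \<Rightarrow> nat \<Rightarrow> real^4) \<Rightarrow> bool" where
  "difference_equations T k lam fR fI Nx Nt r \<longleftrightarrow>
     (\<forall>n<Nt. \<forall>j i. imposed Nx i j \<longrightarrow> residual T k lam fR fI Nx Nt r n j $ i = 0)"

definition grid_boundary_conditions ::
  "real \<Rightarrow> real \<Rightarrow> real \<Rightarrow> real \<Rightarrow> nat \<Rightarrow> nat \<Rightarrow> (nat \<Rightarrow> nat \<Rightarrow> real^4) \<Rightarrow> bool" where
  "grid_boundary_conditions g0R g0I g1R g1I Nx Nt r \<longleftrightarrow>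
     (\<forall>n\<le>Nt. boundary_values g0R g0I g1R g1I (r n 0) (r n Nx))"

(* r_init is the initial state of (R), i.e. the function x \<mapsto> r(0,x) on [0,1]. *)
definition scheme_S ::
  "real \<Rightarrow> real \<Rightarrow> real^4 \<Rightarrow> (real \<Rightarrow> real) \<Rightarrow> (real \<Rightarrow> real) \<Rightarrow>
   real \<Rightarrow> real \<Rightarrow> real \<Rightarrow> real \<Rightarrow> (real \<Rightarrow> real^4) \<Rightarrow> nat \<Rightarrow> nat \<Rightarrow>
   (nat \<Rightarrow> nat \<Rightarrow> real^4) \<Rightarrow> bool" where
  "scheme_S T k lam fR fI g0R g0I g1R g1I r_init Nx Nt r \<longleftrightarrow>
     difference_equations T k lam fR fI Nx Nt r \<and>
     (\<forall>j\<le>Nx. r 0 j = r_init (xgrid Nx j)) \<and>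
     grid_boundary_conditions g0R g0I g1R g1I Nx Nt r"

definition CFL :: "real \<Rightarrow> real^4 \<Rightarrow> nat \<Rightarrow> nat \<Rightarrow> bool" where
  "CFL T lam Nx Nt \<longleftrightarrow>
     Max {lam $ 1, lam $ 2, \<bar>lam $ 3\<bar>, \<bar>lam $ 4\<bar>} * dt T Nt / dx Nx < 1"

definition grid_max_norm :: "nat \<Rightarrow> (nat \<Rightarrow> real^4) \<Rightarrow> real" where
  "grid_max_norm Nx v = Max ((\<lambda>j. norm (v j)) ` {0..Nx})"

end

(* For a state u with u' = M u + Phi + G, the variation of constants formula says that the
   defect u(b) - transport a b (u a) is the integral of e^((b - x)M) G(x) over [a, b]. A steady
   state has G = 0, so the spatial differences of the scheme vanish on it. For a smooth
   solution of (R) the defect divided by b - a tends to G(b), and the differential equation is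
   u_t + Lambda G = 0. For stability, the upwind update is a convex combination under the CFL
   condition, up to the factor e^(hM) = I + O(h), so the component-wise maximum of a
   difference of two grid functions grows by a factor 1 + O(dt) per step. *)
theory Submission
  imports Defs
begin

section \<open>Matrix products and the matrix exponential\<close>

lemma bounded_bilinear_matrix_vector_mult:
  "bounded_bilinear ((*v) :: real^'n^'m \<Rightarrow> real^'n \<Rightarrow> real^'m)"
  unfolding bilinear_conv_bounded_bilinear[symmetric] bilinear_def
  by (auto intro!: linearI simp: matrix_vector_mult_add_rdistrib matrix_vector_right_distrib
      matrix_vector_mult_scaleR scaleR_matrix_vector_assoc)

lemma bounded_bilinear_matrix_matrix_mult:
  "bounded_bilinear ((**) :: real^'n^'m \<Rightarrow> real^'p^'n \<Rightarrow> real^'p^'m)"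
  unfolding bilinear_conv_bounded_bilinear[symmetric] bilinear_def
  by (auto intro!: linearI simp: vec_eq_iff matrix_matrix_mult_def sum.distrib
      sum_distrib_left algebra_simps)

lemma vec_has_vector_derivativeI:
  fixes f :: "real \<Rightarrow> 'a::real_normed_vector^'n"
  assumes "\<And>i. ((\<lambda>x. f x $ i) has_vector_derivative f' $ i) F"
  shows "(f has_vector_derivative f') F"
  using assms
  unfolding has_vector_derivative_def has_derivative_def
  by (auto intro!: vec_tendstoI bounded_linear_scaleR_left)

text \<open>The iterate inside \<open>matrix_exp\<close> under its own name: multiplication in this
  type is componentwise, so matrix powers have to be built from \<open>**\<close>.\<close>

definition mpow :: "real^'n^'n \<Rightarrow> nat \<Rightarrow> real^'n^'n" where
  "mpow A n = ((\<lambda>B. A ** B) ^^ n) (mat 1)"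

lemma mpow_simps [simp]: "mpow A 0 = mat 1" "mpow A (Suc n) = A ** mpow A n"
  by (simp_all add: mpow_def)

lemma mpow_commute: "mpow A n ** A = A ** mpow A n"
  by (induction n) (simp_all add: matrix_mul_assoc[symmetric])

lemma mpow_scaleR: "mpow (x *\<^sub>R A) n = x ^ n *\<^sub>R mpow A n"
  by (induction n) (simp_all add: matrix_scalar_ac scalar_matrix_assoc[symmetric] mult.commute)

text \<open>Each entry of a product is a sum of \<open>CARD('n')\<close> products, so a further
  factor \<open>A\<close> costs at most \<open>CARD('n') * m\<close>. Such geometric growth is
  beaten by the factorial in the exponential series.\<close>

lemma mpow_entry_bound:
  fixes A :: "real^'n^'n"
  fixes m :: real
  assumes "\<And>i j. \<bar>A $ i $ j\<bar> \<le> m"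
  shows "\<bar>mpow A n $ i $ j\<bar> \<le> (CARD('n) * m) ^ n"
proof (induction n arbitrary: i j)
  case 0
  then show ?case by (simp add: mat_def)
next
  case (Suc n)
  have "\<bar>mpow A (Suc n) $ i $ j\<bar> \<le> (\<Sum>l\<in>UNIV. \<bar>A $ i $ l * mpow A n $ l $ j\<bar>)"
    by (simp add: matrix_matrix_mult_def sum_abs)
  also have "\<dots> \<le> (\<Sum>l\<in>(UNIV::'n set). m * (CARD('n) * m) ^ n)"
    unfolding abs_mult using order_trans[OF abs_ge_zero assms]
    by (intro sum_mono mult_mono assms Suc.IH) auto
  finally show ?case by simp
qed

text \<open>Comparison with the scalar exponential series. With the entry fixed this is a real power
  series in \<open>x\<close>, written with the coefficient first so that termwise differentiation
  applies.\<close>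

lemma summable_mpow_entry:
  fixes A :: "real^'n^'n"
  shows "summable (\<lambda>n. mpow A n $ i $ j / fact n * x ^ n)"
proof -
  have m: "\<bar>A $ i $ j\<bar> \<le> norm A" for i j
    using order_trans[OF Finite_Cartesian_Product.norm_nth_le Finite_Cartesian_Product.norm_nth_le,
        of "A" i j] by simp
  have "summable (\<lambda>n. inverse (fact n) * (CARD('n) * norm A * \<bar>x\<bar>) ^ n)"
    by (rule summable_exp)
  then show ?thesis
  proof (rule summable_comparison_test')
    fix n :: nat assume "n \<ge> 0"
    show "norm (mpow A n $ i $ j / fact n * x ^ n)
        \<le> inverse (fact n) * (CARD('n) * norm A * \<bar>x\<bar>) ^ n"
      using mult_right_mono[OF mpow_entry_bound[OF m, of n i j], of "\<bar>x\<bar> ^ n / fact n"]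
      by (simp add: abs_mult power_abs power_mult_distrib field_simps)
  qed
qed

text \<open>Turns the infinite sum of the definition, which by itself says nothing about
  convergence, into genuine convergence; limits of matrices are taken entry by entry.\<close>

lemma matrix_exp_sums:
  "(\<lambda>n. (x ^ n / fact n) *\<^sub>R mpow A n) sums matrix_exp (x *\<^sub>R A)"
proof -
  have "(\<lambda>n. (x ^ n / fact n) *\<^sub>R mpow A n) sums
      (\<chi> i j. \<Sum>n. mpow A n $ i $ j / fact n * x ^ n)"
    unfolding sums_def
  proof (intro vec_tendstoI)
    fix i j
    show "(\<lambda>N. (\<Sum>n<N. (x ^ n / fact n) *\<^sub>R mpow A n) $ i $ j) \<longlonglongrightarrow>
       (\<chi> i j. \<Sum>n. mpow A n $ i $ j / fact n * x ^ n) $ i $ j"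
      using summable_LIMSEQ[OF summable_mpow_entry[of A i j x]] by (simp add: mult_ac)
  qed
  moreover have "matrix_exp (x *\<^sub>R A) = (\<Sum>n. (x ^ n / fact n) *\<^sub>R mpow A n)"
    by (simp add: matrix_exp_def mpow_def[symmetric] mpow_scaleR)
  ultimately show ?thesis by (simp add: sums_iff)
qed

lemma matrix_exp_0 [simp]: "matrix_exp (0 :: real^'n^'n) = mat 1"
proof -
  have "(\<lambda>n. (0 ^ n / fact n) *\<^sub>R mpow A n) sums (mat 1 :: real^'n^'n)" for A :: "real^'n^'n"
    using sums_single[of 0 "\<lambda>n. (0 ^ n / fact n) *\<^sub>R mpow A n"] 
    by (auto elim!: back_subst[of "\<lambda>f. f sums _"] simp: fun_eq_iff)
  from sums_unique2[OF this matrix_exp_sums[of 0]] show ?thesis by (simp add: eq_commute)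
qed

text \<open>Multiplication by \<open>A\<close> on either side is continuous and linear, so it may be
  carried out term by term, where powers of \<open>A\<close> commute with \<open>A\<close>.\<close>

lemma matrix_exp_commute: "A ** matrix_exp (x *\<^sub>R A) = matrix_exp (x *\<^sub>R A) ** A"
proof -
  have "(\<lambda>n. A ** ((x ^ n / fact n) *\<^sub>R mpow A n)) sums (A ** matrix_exp (x *\<^sub>R A))"
    by (rule bounded_linear.sums[OF bounded_bilinear.bounded_linear_right
          [OF bounded_bilinear_matrix_matrix_mult] matrix_exp_sums])
  moreover have "(\<lambda>n. ((x ^ n / fact n) *\<^sub>R mpow A n) ** A) sums (matrix_exp (x *\<^sub>R A) ** A)"
    by (rule bounded_linear.sums[OF bounded_bilinear.bounded_linear_left
          [OF bounded_bilinear_matrix_matrix_mult] matrix_exp_sums])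
  ultimately show ?thesis
    by (simp add: matrix_scalar_ac scalar_matrix_assoc[symmetric] mpow_commute sums_iff)
qed

text \<open>Each entry is a power series in \<open>x\<close> that converges everywhere and may be
  differentiated term by term.\<close>

lemma matrix_exp_has_vector_derivative:
  fixes A :: "real^'n^'n"
  shows "((\<lambda>x. matrix_exp (x *\<^sub>R A)) has_vector_derivative A ** matrix_exp (x *\<^sub>R A)) (at x)"
proof (intro vec_has_vector_derivativeI)
  fix i j :: 'n
  have E: "(\<lambda>n. B ** ((x ^ n / fact n) *\<^sub>R mpow A n)) sums (B ** matrix_exp (x *\<^sub>R A))"
    for B :: "real^'n^'n" and x
    by (rule bounded_linear.sums[OF bounded_bilinear.bounded_linear_right
          [OF bounded_bilinear_matrix_matrix_mult] matrix_exp_sums])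
  have entry: "(B ** matrix_exp (x *\<^sub>R A)) $ i $ j = (\<Sum>n. (B ** mpow A n) $ i $ j / fact n * x ^ n)"
    for B :: "real^'n^'n" and x
    using bounded_linear.sums[OF bounded_linear_compose[OF bounded_linear_vec_nth bounded_linear_vec_nth] E[of B x], of i j]
    by (simp add: matrix_scalar_ac scalar_matrix_assoc[symmetric] sums_iff mult_ac)
  \<comment> \<open>Differentiation shifts the coefficients by one: the factor \<open>n + 1\<close>
    cancels against \<open>fact (n + 1)\<close> and leaves one extra factor
    \<open>A\<close>.\<close>
  have "diffs (\<lambda>n. mpow A n $ i $ j / fact n) = (\<lambda>n. (A ** mpow A n) $ i $ j / fact n)"
    by (simp add: diffs_def fun_eq_iff)
  \<comment> \<open>The factor \<open>mat 1\<close> lets \<open>entry\<close> rewrite the function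
    and its derivative alike, with \<open>B = mat 1\<close> and \<open>B = A\<close>.\<close>
  then have "((\<lambda>x. (mat 1 ** matrix_exp (x *\<^sub>R A)) $ i $ j)
      has_field_derivative (A ** matrix_exp (x *\<^sub>R A)) $ i $ j) (at x)"
    unfolding entry
    using termdiffs_strong_converges_everywhere[OF summable_mpow_entry[of A i j], of x] by simp
  then show "((\<lambda>x. matrix_exp (x *\<^sub>R A) $ i $ j) has_vector_derivative
      (A ** matrix_exp (x *\<^sub>R A)) $ i $ j) (at x)"
    by (simp add: has_real_derivative_iff_has_vector_derivative)
qed


lemma matrix_exp_affine_derivative:
  "((\<lambda>x. matrix_exp ((c + s * x) *\<^sub>R A)) has_vector_derivative
    s *\<^sub>R (A ** matrix_exp ((c + s * x) *\<^sub>R A))) (at x within S)"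
proof -
  have "((\<lambda>x. c + s * x) has_vector_derivative s) (at x)"
    by (auto intro!: derivative_eq_intros)
  from vector_diff_chain_at[OF this matrix_exp_has_vector_derivative[of A]]
  have "((\<lambda>x. matrix_exp ((c + s * x) *\<^sub>R A)) has_vector_derivative
      s *\<^sub>R (A ** matrix_exp ((c + s * x) *\<^sub>R A))) (at x)"
    by (simp add: o_def)
  then show ?thesis by (rule has_vector_derivative_at_within)
qed

text \<open>\<open>?D\<close> is constant because its derivative vanishes: the two contributions of
  the product rule cancel, as \<open>A\<close> commutes with its exponential. The claim compares the
  values of \<open>?D\<close> at \<open>- s\<close> and \<open>0\<close>.\<close>

lemma matrix_exp_add:
  "matrix_exp (s *\<^sub>R A) ** matrix_exp (t *\<^sub>R A) = matrix_exp ((s + t) *\<^sub>R A)"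
proof -
  let ?D = "\<lambda>x. matrix_exp ((0 + (-1) * x) *\<^sub>R A) ** matrix_exp ((s + t + 1 * x) *\<^sub>R A)"
  have "(?D has_vector_derivative 0) (at x)" for x
    using bounded_bilinear.has_vector_derivative[OF bounded_bilinear_matrix_matrix_mult
        matrix_exp_affine_derivative[of 0 "-1" A x UNIV] matrix_exp_affine_derivative[of "s + t" 1 A x UNIV]]
      matrix_exp_commute[of A "-x"]
    by (simp add: matrix_mul_assoc bounded_bilinear.minus_left[OF bounded_bilinear_matrix_matrix_mult])
  then have "\<exists>c. \<forall>x\<in>UNIV. ?D x = c"
    by (intro has_derivative_zero_constant) (auto simp: has_vector_derivative_def)
  then have "?D (- s) = ?D 0" by (metis UNIV_I)
  then show ?thesis by simp
qed

text \<open>Makes exp(hA) = I + O(h) quantitative by the mean value inequality on [-1, 1], where the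
  derivative is bounded by compactness. \<open>C\<close> depends on \<open>A\<close> alone, which
  keeps the later stability constant independent of grid and data.\<close>

lemma matrix_exp_near_identity:
  fixes A :: "real^'n^'n"
  obtains C where "C \<ge> 0"
    and "\<And>h v. \<bar>h\<bar> \<le> 1 \<Longrightarrow> norm (matrix_exp (h *\<^sub>R A) *v v - v) \<le> C * \<bar>h\<bar> * norm v"
proof -
  let ?E = "\<lambda>x. matrix_exp (x *\<^sub>R A)"
  note D = matrix_exp_has_vector_derivative[of A]
  have "continuous_on {-1..1} ?E"
    by (rule continuous_on_vector_derivative) (use D in \<open>blast intro: has_vector_derivative_at_within\<close>)
  then have "continuous_on {-1..1} (\<lambda>x. A ** ?E x)"
    by (intro bounded_bilinear.continuous_on[OF bounded_bilinear_matrix_matrix_mult] continuous_on_const)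
  then have "bounded ((\<lambda>x. A ** ?E x) ` {-1..1})"
    by (intro compact_imp_bounded compact_continuous_image) auto
  then obtain B where B: "\<And>x. x \<in> {-1..1} \<Longrightarrow> norm (A ** ?E x) \<le> B"
    unfolding bounded_iff by blast
  \<comment> \<open>The norm of a matrix is the Euclidean norm here, not the operator norm, so the
    product estimate is taken with a constant \<open>K\<close>.\<close>
  obtain K where K: "K > 0" "\<And>(M :: real^'n^'n) v. norm (M *v v) \<le> norm M * norm v * K"
    using bounded_bilinear.pos_bounded[OF bounded_bilinear_matrix_vector_mult] by blast
  have B0: "B \<ge> 0" using order_trans[OF norm_ge_zero B[of 0]] by simp
  show ?thesis
  proof (rule that[of "B * K"])
    show "B * K \<ge> 0" using B0 K by simp
    fix h :: real and v :: "real^'n"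
    assume h: "\<bar>h\<bar> \<le> 1"
    have "norm (?E h - ?E 0) \<le> B * norm (h - 0)"
    proof (rule differentiable_bound)
      show "(?E has_derivative (\<lambda>h. h *\<^sub>R (A ** ?E x))) (at x within {-1..1})" for x
        using D[of x] by (simp add: has_vector_derivative_def has_derivative_at_withinI)
      show "onorm (\<lambda>h. h *\<^sub>R (A ** ?E x)) \<le> B" if "x \<in> {-1..1}" for x
        using B[OF that] by (intro onorm_le) (metis mult.commute mult_right_mono norm_ge_zero norm_scaleR real_norm_def)
    qed (use h in auto)
    then have E: "norm (?E h - mat 1) \<le> B * \<bar>h\<bar>" by simp
    have "norm (?E h *v v - v) = norm ((?E h - mat 1) *v v)"
      by (simp add: matrix_vector_mult_diff_rdistrib)
    also have "\<dots> \<le> norm (?E h - mat 1) * norm v * K" by (rule K)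
    also have "\<dots> \<le> B * \<bar>h\<bar> * norm v * K"
      using E K by (intro mult_right_mono) auto
    finally show "norm (?E h *v v - v) \<le> B * K * \<bar>h\<bar> * norm v" by (simp add: mult_ac)
  qed
qed

section \<open>Continuity of the data and variation of constants for the steady equation\<close>

lemma C1_unit_interval_continuous: "C1_unit_interval f \<Longrightarrow> continuous_on {0..1} f"
  unfolding C1_unit_interval_def using DERIV_continuous_on by blast

lemma continuous_on_Phi:
  assumes "continuous_on S fR" "continuous_on S fI"
  shows "continuous_on S (Phi fR fI)"
proof -
  have "Phi fR fI = (\<lambda>x. fR x *\<^sub>R vector [1, 0, 1, 0] + fI x *\<^sub>R vector [0, 1, 0, 1])"
    by (auto simp: Phi_def fun_eq_iff vec_eq_iff forall_4 vector_4_nth)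
  then show ?thesis using assms by (auto intro!: continuous_intros)
qed

text \<open>Variation of constants, in the form that avoids integrating \<open>G\<close>: the mean value
  inequality is applied to \<open>x \<mapsto> exp ((b - x) M) u(x)\<close> minus a primitive of the \<open>Phi\<close>-part.\<close>
lemma transport_defect:
  assumes f: "continuous_on {0..1} fR" "continuous_on {0..1} fI"
    and u: "\<And>x. x \<in> {0..1} \<Longrightarrow>
      (u has_vector_derivative (Mmat k *v u x + Phi fR fI x + G x)) (at x within {0..1})"
    and ab: "a \<in> {0..1}" "b \<in> {0..1}"
    and G: "\<And>x. x \<in> closed_segment a b \<Longrightarrow>
      norm (matrix_exp ((b - x) *\<^sub>R Mmat k) *v G x - G b) \<le> e"
  shows "norm (u b - transport k fR fI a b (u a) - (b - a) *\<^sub>R G b) \<le> e * \<bar>b - a\<bar>"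
proof -
  let ?E = "\<lambda>h. matrix_exp (h *\<^sub>R Mmat k)"
  note bil = bounded_bilinear.has_vector_derivative[OF bounded_bilinear_matrix_vector_mult]
  have E_comp: "?E s *v (?E t *v v) = ?E (s + t) *v v" for s t v
    by (simp add: matrix_vector_mul_assoc matrix_exp_add)
  \<comment> \<open>\<open>Mmat k\<close> is put to the right of the exponential, so that it meets
    \<open>u x\<close> directly and cancels the matrix term in the derivative of
    \<open>u\<close>.\<close>
  have dE: "((\<lambda>x. ?E (c - x)) has_vector_derivative - (?E (c - x) ** Mmat k)) (at x within S)"
    for c x S
    using matrix_exp_affine_derivative[of c "-1" "Mmat k" x S]
    by (simp add: matrix_exp_commute)
  have "continuous_on {0..1} (\<lambda>x. ?E (a - x))"
    by (rule continuous_on_vector_derivative) (rule dE)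
  then have cont: "continuous_on {0..1} (\<lambda>x. ?E (a - x) *v Phi fR fI x)"
    by (intro bounded_bilinear.continuous_on[OF bounded_bilinear_matrix_vector_mult] continuous_on_Phi f)
  \<comment> \<open>A primitive whose increment from \<open>a\<close> to \<open>b\<close> is the
    oriented integral in \<open>transport\<close>, for either order of \<open>a\<close> and
    \<open>b\<close>.\<close>
  then obtain P where P: "\<And>x. x \<in> {0..1} \<Longrightarrow>
      (P has_vector_derivative ?E (a - x) *v Phi fR fI x) (at x within {0..1})"
    using antiderivative_continuous by blast
  have sub: "{min a b..max a b} \<subseteq> {0..1}" using ab by auto
  have int: "(LBINT x=a..b. ?E (- (x - a)) *v Phi fR fI x) = P b - P a"
  proof (rule interval_integral_FTC_finite)
    show "continuous_on {min a b..max a b} (\<lambda>x. ?E (- (x - a)) *v Phi fR fI x)"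
      using continuous_on_subset[OF cont sub] by simp
    fix x assume "min a b \<le> x" "x \<le> max a b"
    then have "x \<in> {0..1}" using sub by auto
    from has_vector_derivative_within_subset[OF P[OF this] sub]
    show "(P has_vector_derivative ?E (- (x - a)) *v Phi fR fI x) (at x within {min a b..max a b})"
      by simp
  qed
  \<comment> \<open>In the derivative of \<open>V\<close> the \<open>Mmat k\<close> terms cancel by
    the product rule and the \<open>Phi\<close> terms by the semigroup law, which leaves only the
    transported \<open>G\<close>.\<close>
  define V where "V x = ?E (b - x) *v u x - ?E (b - a) *v P x" for x
  have V: "(V has_vector_derivative ?E (b - x) *v G x) (at x within {0..1})" if "x \<in> {0..1}" for x
  proof -
    have "(V has_vector_derivative
        (?E (b - x) *v (Mmat k *v u x + Phi fR fI x + G x) + - (?E (b - x) ** Mmat k) *v u x)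
        - ?E (b - a) *v (?E (a - x) *v Phi fR fI x)) (at x within {0..1})"
      unfolding V_def
      by (intro has_vector_derivative_diff bil dE u that
          bounded_linear.has_vector_derivative[OF matrix_vector_mul_bounded_linear] P)
    then show ?thesis
      unfolding E_comp
      by (simp add: matrix_vector_right_distrib matrix_vector_mul_assoc
          bounded_bilinear.minus_left[OF bounded_bilinear_matrix_vector_mult])
  qed
  have seg: "closed_segment a b \<subseteq> {0..1}" using sub by (auto simp: closed_segment_eq_real_ivl)
  \<comment> \<open>Linearization at the endpoint \<open>b\<close>, where the exponential is the
    identity and the derivative of \<open>V\<close> equals \<open>G b\<close>.\<close>
  have "norm (V b - V a - (b - a) *\<^sub>R (?E (b - b) *v G b)) \<le> norm (b - a) * e"
    by (rule vector_differentiable_bound_linearization[where S = "closed_segment a b"])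
       (use seg G in \<open>auto intro: has_vector_derivative_within_subset[OF V]\<close>)
  moreover have "u b - transport k fR fI a b (u a) = V b - V a"
    unfolding transport_def int V_def by (simp add: algebra_simps)
  ultimately show ?thesis by (simp add: mult.commute)
qed


section \<open>The scheme in upwind form, component by component\<close>

lemma diag_mult_nth: "(diag v *v w) $ i = v $ i * w $ i"
  by (simp add: diag_def matrix_vector_mult_def if_distrib[of "\<lambda>x. x * _"] cong: if_cong)

lemma Lam_plus_nth:
  "(Lam_plus lam *v w) $ 1 = lam $ 1 * w $ 1" "(Lam_plus lam *v w) $ 2 = lam $ 2 * w $ 2"
  "(Lam_plus lam *v w) $ 3 = 0" "(Lam_plus lam *v w) $ 4 = 0"
  by (simp_all add: Lam_plus_def diag_mult_nth vector_4_nth)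

lemma Lam_minus_nth:
  "(Lam_minus lam *v w) $ 1 = 0" "(Lam_minus lam *v w) $ 2 = 0"
  "(Lam_minus lam *v w) $ 3 = lam $ 3 * w $ 3" "(Lam_minus lam *v w) $ 4 = lam $ 4 * w $ 4"
  by (simp_all add: Lam_minus_def diag_mult_nth vector_4_nth)

text \<open>The truncated \<open>j - 1\<close> at \<open>j = 0\<close> and the value \<open>j + 1\<close> at \<open>j = Nx\<close> occur only where the
  equation for component \<open>i\<close> is not imposed.\<close>
definition upwind :: "4 \<Rightarrow> nat \<Rightarrow> nat" where
  "upwind i j = (if i \<in> {1, 2} then j - 1 else j + 1)"

lemma xgrid_in_unit: "j \<le> Nx \<Longrightarrow> xgrid Nx j \<in> {0..1}"
  \<comment> \<open>For \<open>Nx = 0\<close> the convention \<open>1 / 0 = 0\<close> makes the only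
    grid point 0.\<close>
  by (cases "Nx = 0") (auto simp: xgrid_def dx_def)

lemma imposed_upwind:
  assumes "imposed Nx i j"
  shows "j \<le> Nx" "upwind i j \<le> Nx"
  using assms by (auto simp: imposed_def upwind_def)

lemma xgrid_upwind:
  assumes "imposed Nx i j"
  shows "xgrid Nx j - xgrid Nx (upwind i j) = (if i \<in> {1, 2} then dx Nx else - dx Nx)"
  using assms by (auto simp: imposed_def upwind_def xgrid_def algebra_simps of_nat_diff)

text \<open>The forward difference of components 3 and 4 and the backward difference of components 1
  and 2 become the same quotient once both are taken over the signed distance to the upwind point.
  All three claims work from this form.\<close>

lemma residual_upwind:
  assumes "imposed Nx i j"
  shows "residual T k lam fR fI Nx Nt r n j $ i =
    (r (n + 1) j $ i - r n j $ i) / dt T Nt +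
    lam $ i * (r n j - transport k fR fI (xgrid Nx (upwind i j)) (xgrid Nx j) (r n (upwind i j))) $ i
      / (xgrid Nx j - xgrid Nx (upwind i j))"
  unfolding xgrid_upwind[OF assms]
  using exhaust_4[of i]
  by (auto simp: residual_def upwind_def Lam_plus_nth Lam_minus_nth
      algebra_simps diff_divide_distrib)

text \<open>Where no equation is imposed, the component is prescribed by the boundary conditions,
  with a value independent of time. Two time levels and two grid functions are allowed, so that both
  steadiness and stability can use it.\<close>

lemma boundary_components_eq:
  assumes "grid_boundary_conditions g0R g0I g1R g1I Nx Nt r"
    and "grid_boundary_conditions g0R g0I g1R g1I Nx Nt s"
    and "n \<le> Nt" "m \<le> Nt" "j \<le> Nx" "\<not> imposed Nx i j"
  shows "r n j $ i = s m j $ i"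
proof -
  have "(i \<in> {1, 2} \<and> j = 0) \<or> (i \<in> {3, 4} \<and> j = Nx)"
    using assms(5,6) exhaust_4[of i] by (auto simp: imposed_def)
  then show ?thesis
    using assms(1-4) by (auto simp: grid_boundary_conditions_def boundary_values_def)
qed

lemma dt_pos: "T > 0 \<Longrightarrow> Nt > 0 \<Longrightarrow> dt T Nt > 0"
  by (simp add: dt_def)

lemma dx_pos: "Nx > 0 \<Longrightarrow> dx Nx > 0"
  by (simp add: dx_def)

lemma tgrid_in_interval: "T > 0 \<Longrightarrow> n \<le> Nt \<Longrightarrow> tgrid T Nt n \<in> {0..T}"
  by (cases "Nt = 0") (auto simp: tgrid_def dt_def field_simps)

text \<open>\<open>Lam lam\<close> acts componentwise, so everything but the time derivative can be
  collected into \<open>lam $ i\<close> times the defect of the steady equation, the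
  \<open>G\<close> of the variation of constants formula.\<close>

lemma Lam_mult_eq_iff:
  "rt + Lam lam *v rx = (Lam lam ** Mmat k) *v u + Lam lam *v w \<longleftrightarrow>
   (\<forall>i. rt $ i + lam $ i * (rx - Mmat k *v u - w) $ i = 0)"
proof -
  have "(rt + Lam lam *v rx = (Lam lam ** Mmat k) *v u + Lam lam *v w) \<longleftrightarrow>
      (\<forall>i. rt $ i + lam $ i * rx $ i = lam $ i * (Mmat k *v u) $ i + lam $ i * w $ i)"
    unfolding matrix_vector_mul_assoc[symmetric] vec_eq_iff
    by (simp add: Lam_def diag_mult_nth)
  also have "\<dots> \<longleftrightarrow> (\<forall>i. rt $ i + lam $ i * (rx - Mmat k *v u - w) $ i = 0)"
    by (auto simp: algebra_simps)
  finally show ?thesis .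
qed

section \<open>Preservation of steady states\<close>

text \<open>The equation is given only in the interior. Integrating it there and using continuity of
  \<open>rs\<close> writes \<open>rs\<close> as an integral of a function continuous on [0, 1], and
  this representation is differentiable up to both endpoints.\<close>

lemma steady_state_has_vector_derivative:
  assumes T: "T > 0" and lam: "\<And>i. lam $ i \<noteq> 0"
    and f: "continuous_on {0..1} fR" "continuous_on {0..1} fI"
    and cont: "continuous_on {0..1} rs"
    and pde: "pde_R T k lam fR fI (\<lambda>t x. rs x)"
    and x: "x \<in> {0..1}"
  shows "(rs has_vector_derivative (Mmat k *v rs x + Phi fR fI x)) (at x within {0..1})"
proof -
  let ?g = "\<lambda>x. Mmat k *v rs x + Phi fR fI x"
  have interior: "(rs has_vector_derivative ?g y) (at y)" if y: "y \<in> {0<..<1}" for y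
  proof -
    \<comment> \<open>For a stationary state any positive time serves; \<open>T\<close> is
      one.\<close>
    from pde y T obtain rt rx where
      rt: "((\<lambda>s. rs y) has_vector_derivative rt) (at T within {0..T})" and
      rx: "(rs has_vector_derivative rx) (at y)" and
      eq: "rt + Lam lam *v rx = (Lam lam ** Mmat k) *v rs y + Lam lam *v Phi fR fI y"
      unfolding pde_R_def by (meson greaterThanAtMost_iff order_refl)
    have "rt = 0"
      using vector_derivative_unique_within_closed_interval[of 0 T T "\<lambda>s. rs y" rt 0] T rt by auto
    \<comment> \<open>The time derivative being 0, the nonzero speed \<open>lam $ i\<close> can be
      divided out.\<close>
    with eq have "(rx - Mmat k *v rs y - Phi fR fI y) $ i = 0" for i
      using lam[of i] unfolding Lam_mult_eq_iff by (metis add_0 mult_eq_0_iff zero_index)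
    then have "rx - Mmat k *v rs y - Phi fR fI y = 0" by (simp add: vec_eq_iff)
    then have "rx = ?g y" by (simp add: algebra_simps)
    with rx show ?thesis by simp
  qed
  have g: "continuous_on {0..1} ?g"
    by (intro continuous_on_add continuous_on_Phi f
        bounded_linear.continuous_on[OF matrix_vector_mul_bounded_linear cont])
  have rs_eq: "rs y = rs 0 + integral {0..y} ?g" if "y \<in> {0..1}" for y
  proof -
    \<comment> \<open>This form of the fundamental theorem asks for the derivative only in the
      interior and for continuity at the ends.\<close>
    have "(?g has_integral (rs y - rs 0)) {0..y}"
      using that
      by (intro fundamental_theorem_of_calculus_interior continuous_on_subset[OF cont] interior) auto
    then show ?thesis by (simp add: integral_unique)
  qed
  have "((\<lambda>y. rs 0 + integral {0..y} ?g) has_vector_derivative 0 + ?g x) (at x within {0..1})"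
    by (intro has_vector_derivative_add has_vector_derivative_const integral_has_vector_derivative g x)
  then show ?thesis
    using has_vector_derivative_transform[OF x rs_eq] by simp
qed

text \<open>Transport is the exact solution operator of the steady equation, so every spatial
  difference vanishes on \<open>rs\<close> and the residual reduces to the time difference. The
  remaining components are boundary data.\<close>

lemma scheme_preserves_steady_state:
  assumes T: "T > 0" and lam: "\<And>i. lam $ i \<noteq> 0"
    and f: "continuous_on {0..1} fR" "continuous_on {0..1} fI"
    and steady: "steady_state_R T k lam fR fI g0R g0I g1R g1I rs"
    and N: "Nx > 0" "Nt > 0"
    and scheme: "difference_equations T k lam fR fI Nx Nt r"
      "grid_boundary_conditions g0R g0I g1R g1I Nx Nt r"
    and n: "n < Nt" and rs: "\<And>j. j \<le> Nx \<Longrightarrow> r n j = rs (xgrid Nx j)"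
    and j: "j \<le> Nx"
  shows "r (n + 1) j = r n j"
  unfolding vec_eq_iff
proof
  fix i
  show "r (n + 1) j $ i = r n j $ i"
  proof (cases "imposed Nx i j")
    case True
    let ?a = "xgrid Nx (upwind i j)" and ?b = "xgrid Nx j"
    have "(rs has_vector_derivative (Mmat k *v rs x + Phi fR fI x + 0)) (at x within {0..1})"
      if "x \<in> {0..1}" for x
      using steady_state_has_vector_derivative[OF T lam f _ _ that] steady
      by (simp add: steady_state_R_def)
    \<comment> \<open>With \<open>G = 0\<close> and \<open>e = 0\<close> the defect estimate becomes
      an equality.\<close>
    then have "norm (rs ?b - transport k fR fI ?a ?b (rs ?a) - (?b - ?a) *\<^sub>R 0) \<le> 0 * \<bar>?b - ?a\<bar>"
      by (rule transport_defect[OF f]) (use imposed_upwind[OF True] xgrid_in_unit in auto)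
    then have "r n j - transport k fR fI ?a ?b (r n (upwind i j)) = 0"
      using rs imposed_upwind[OF True] by simp
    moreover have "residual T k lam fR fI Nx Nt r n j $ i = 0"
      using scheme n True by (auto simp: difference_equations_def)
    ultimately show ?thesis
      unfolding residual_upwind[OF True] using dt_pos[OF T N(2)] by simp
  next
    case False
    then show ?thesis using boundary_components_eq[OF scheme(2,2)] n j by auto
  qed
qed

section \<open>Stability under the CFL condition\<close>

text \<open>The source integral is common to both states and drops out, so the error obeys a
  homogeneous scheme.\<close>

lemma transport_diff:
  "transport k fR fI a b u - transport k fR fI a b v = matrix_exp ((b - a) *\<^sub>R Mmat k) *v (u - v)"
  by (simp add: transport_def algebra_simps)

text \<open>Goes through the l1 norm; the crude factor 4 affects only constants.\<close>

lemma norm_le_4_times_component: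
  fixes v :: "real^4"
  assumes "\<And>i. \<bar>v $ i\<bar> \<le> B"
  shows "norm v \<le> 4 * B"
  using norm_le_l1_cart[of v] sum_mono[of UNIV "\<lambda>i. \<bar>v $ i\<bar>" "\<lambda>i. B"] assms by simp

text \<open>This is the upwind property: speed and signed step share their sign, so the Courant
  number below is nonnegative.\<close>

lemma upwind_speed:
  assumes "imposed Nx i j" "lam $ 1 > 0" "lam $ 2 > 0" "lam $ 3 < 0" "lam $ 4 < 0"
  shows "lam $ i / (xgrid Nx j - xgrid Nx (upwind i j)) = \<bar>lam $ i\<bar> / dx Nx"
  unfolding xgrid_upwind[OF assms(1)] using exhaust_4[of i] assms(2-) by auto

text \<open>Errors are measured by components because the Courant number depends on
  \<open>i\<close>. The new error is a convex combination of two old ones plus a remainder from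
  exp(hM) - I, which is bounded by a multiple of \<open>dt T Nt * B\<close>.\<close>

lemma scheme_difference_step:
  assumes T: "T > 0" and N: "Nx > 0" "Nt > 0" and n: "n < Nt"
    and lam: "lam $ 1 > 0" "lam $ 2 > 0" "lam $ 3 < 0" "lam $ 4 < 0"
    and L: "\<And>i. \<bar>lam $ i\<bar> \<le> L" "L * dt T Nt / dx Nx < 1"
    and C: "C \<ge> 0" "\<And>h v. \<bar>h\<bar> \<le> 1 \<Longrightarrow>
      norm (matrix_exp (h *\<^sub>R Mmat k) *v v - v) \<le> C * \<bar>h\<bar> * norm v"
    and r: "difference_equations T k lam fR fI Nx Nt r"
      "grid_boundary_conditions g0R g0I g1R g1I Nx Nt r"
    and s: "difference_equations T k lam fR fI Nx Nt s"
      "grid_boundary_conditions g0R g0I g1R g1I Nx Nt s"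
    and B: "\<And>j i. j \<le> Nx \<Longrightarrow> \<bar>(r n j - s n j) $ i\<bar> \<le> B"
    and j: "j \<le> Nx"
  shows "\<bar>(r (n + 1) j - s (n + 1) j) $ i\<bar> \<le> (1 + 4 * C * L * dt T Nt) * B"
proof (cases "imposed Nx i j")
  case True
  let ?d = "\<lambda>n j. r n j - s n j" and ?j = "upwind i j"
  let ?h = "xgrid Nx j - xgrid Nx ?j"
  let ?E = "matrix_exp (?h *\<^sub>R Mmat k)"
  \<comment> \<open>The Courant number of component \<open>i\<close>, below 1 by the CFL
    condition.\<close>
  define mu where "mu = \<bar>lam $ i\<bar> * dt T Nt / dx Nx"
  note pos = dt_pos[OF T N(2)] dx_pos[OF N(1)]
  have mu: "0 \<le> mu" "mu \<le> L * dt T Nt / dx Nx"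
    using pos L(1)[of i] by (auto simp: mu_def intro!: divide_right_mono mult_right_mono)
  then have mu1: "mu < 1" using L(2) by linarith
  have h: "\<bar>?h\<bar> = dx Nx" using xgrid_upwind[OF True] pos by auto
  have dx1: "dx Nx \<le> 1" using N by (simp add: dx_def)
  \<comment> \<open>The difference equation solved for the new time level.\<close>
  have res: "(q (n + 1) j) $ i = q n j $ i - mu * (q n j -
      transport k fR fI (xgrid Nx ?j) (xgrid Nx j) (q n ?j)) $ i"
    if "difference_equations T k lam fR fI Nx Nt q" for q
  proof -
    have "residual T k lam fR fI Nx Nt q n j $ i = 0"
      using that n True by (auto simp: difference_equations_def)
    then have "(q (n + 1) j $ i - q n j $ i) / dt T Nt + \<bar>lam $ i\<bar> / dx Nx *
        (q n j - transport k fR fI (xgrid Nx ?j) (xgrid Nx j) (q n ?j)) $ i = 0"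
      unfolding residual_upwind[OF True] upwind_speed[OF True lam, symmetric] by simp
    then have "dt T Nt * ((q (n + 1) j $ i - q n j $ i) / dt T Nt + \<bar>lam $ i\<bar> / dx Nx *
        (q n j - transport k fR fI (xgrid Nx ?j) (xgrid Nx j) (q n ?j)) $ i) = 0"
      by (simp only: mult_zero_right)
    then show ?thesis using pos by (simp add: mu_def distrib_left mult.commute)
  qed
  have up: "?j \<le> Nx" using imposed_upwind[OF True] by simp
  have "?d (n + 1) j $ i = ?d n j $ i - mu * (?d n j $ i -
      (transport k fR fI (xgrid Nx ?j) (xgrid Nx j) (r n ?j)
        - transport k fR fI (xgrid Nx ?j) (xgrid Nx j) (s n ?j)) $ i)"
    using res[OF r(1)] res[OF s(1)] by (simp add: algebra_simps)
  also have "\<dots> = (1 - mu) * ?d n j $ i + mu * ?d n ?j $ i + mu * (?E *v ?d n ?j - ?d n ?j) $ i"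
    unfolding transport_diff by (simp only: vector_minus_component) (simp add: algebra_simps)
  finally have eq: "?d (n + 1) j $ i = \<dots>" .
  have "\<bar>(?E *v ?d n ?j - ?d n ?j) $ i\<bar> \<le> norm (?E *v ?d n ?j - ?d n ?j)"
    by (rule component_le_norm_cart)
  also have "\<dots> \<le> C * dx Nx * norm (?d n ?j)"
    using C(2)[of ?h "?d n ?j"] h dx1 by simp
  also have "\<dots> \<le> C * dx Nx * (4 * B)"
    using C pos by (intro mult_left_mono norm_le_4_times_component B up) auto
  finally have "mu * \<bar>(?E *v ?d n ?j - ?d n ?j) $ i\<bar> \<le> mu * (C * dx Nx * (4 * B))"
    by (intro mult_left_mono mu)
  \<comment> \<open>In \<open>mu * dx Nx = \<bar>lam $ i\<bar> * dt T Nt\<close> the mesh width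
    cancels, so the remainder is proportional to the time step.\<close>
  moreover have "(mu * dx Nx) * (4 * C * B) \<le> (L * dt T Nt) * (4 * C * B)"
    using mu pos C B[OF j, of i] by (intro mult_right_mono) (auto simp: field_simps)
  moreover have "(1 - mu) * \<bar>?d n j $ i\<bar> \<le> (1 - mu) * B" "mu * \<bar>?d n ?j $ i\<bar> \<le> mu * B"
    using mu mu1 B[OF j, of i] B[OF up, of i] by (auto intro!: mult_left_mono)
  moreover have "\<bar>?d (n + 1) j $ i\<bar> \<le> (1 - mu) * \<bar>?d n j $ i\<bar> + mu * \<bar>?d n ?j $ i\<bar>
      + mu * \<bar>(?E *v ?d n ?j - ?d n ?j) $ i\<bar>"
  proof -
    have "\<bar>?d (n + 1) j $ i\<bar> \<le> \<bar>(1 - mu) * ?d n j $ i\<bar> + \<bar>mu * ?d n ?j $ i\<bar>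
      + \<bar>mu * (?E *v ?d n ?j - ?d n ?j) $ i\<bar>"
      unfolding eq by linarith
    then show ?thesis using mu mu1 by (simp only: abs_mult) simp
  qed
  ultimately show ?thesis by (simp add: algebra_simps)
next
  case False
  \<comment> \<open>The boundary error is 0, so only nonnegativity of the bound is left.\<close>
  have "L \<ge> 0" "B \<ge> 0" using L(1)[of 1] B[of 0 1] by linarith+
  then have "0 \<le> (1 + 4 * C * L * dt T Nt) * B"
    using C dt_pos[OF T N(2)] by simp
  then show ?thesis
    using boundary_components_eq[OF r(2) s(2) _ _ j False, of "n + 1" "n + 1"] n by simp
qed

text \<open>Iterating the one-step bound gives the growth factor
  \<open>(1 + q) ^ n \<le> exp q ^ n\<close>, which stays bounded because
  \<open>n * dt T Nt \<le> T\<close>. The outer factor 4 passes from components back to the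
  Euclidean norm.\<close>

lemma scheme_stable:
  assumes T: "T > 0" and N: "Nx > 0" "Nt > 0"
    and lam: "lam $ 1 > 0" "lam $ 2 > 0" "lam $ 3 < 0" "lam $ 4 < 0"
    and L: "\<And>i. \<bar>lam $ i\<bar> \<le> L" "L * dt T Nt / dx Nx < 1"
    and C: "C \<ge> 0" "\<And>h v. \<bar>h\<bar> \<le> 1 \<Longrightarrow>
      norm (matrix_exp (h *\<^sub>R Mmat k) *v v - v) \<le> C * \<bar>h\<bar> * norm v"
    and r: "difference_equations T k lam fR fI Nx Nt r"
      "grid_boundary_conditions g0R g0I g1R g1I Nx Nt r"
    and s: "difference_equations T k lam fR fI Nx Nt s"
      "grid_boundary_conditions g0R g0I g1R g1I Nx Nt s"
    and n: "n \<le> Nt"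
  shows "grid_max_norm Nx (\<lambda>j. r n j - s n j)
    \<le> 4 * exp (4 * C * L * T) * grid_max_norm Nx (\<lambda>j. r 0 j - s 0 j)"
proof -
  define B where "B = grid_max_norm Nx (\<lambda>j. r 0 j - s 0 j)"
  define q where "q = 4 * C * L * dt T Nt"
  have L0: "L \<ge> 0" using L(1)[of 1] by linarith
  have q: "q \<ge> 0" using L0 C dt_pos[OF T N(2)] by (simp add: q_def)
  have B_ge: "norm (r 0 j - s 0 j) \<le> B" if "j \<le> Nx" for j
    unfolding B_def grid_max_norm_def using that by (intro Max_ge) auto
  have growth: "\<bar>(r n j - s n j) $ i\<bar> \<le> (1 + q) ^ n * B" if "n \<le> Nt" "j \<le> Nx" for n j i
    using that
  proof (induction n arbitrary: j i)
    case 0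
    then show ?case using order_trans[OF component_le_norm_cart B_ge] by simp
  next
    case (Suc n)
    have "\<bar>(r (n + 1) j - s (n + 1) j) $ i\<bar> \<le> (1 + 4 * C * L * dt T Nt) * ((1 + q) ^ n * B)"
      by (rule scheme_difference_step[OF T N _ lam L C r s]) (use Suc in auto)
    then show ?case by (simp add: q_def)
  qed
  have "(1 + q) ^ n \<le> exp q ^ n"
    using q by (intro power_mono exp_ge_add_one_self) auto
  also have "\<dots> = exp (4 * C * L * tgrid T Nt n)"
    by (simp add: exp_of_nat_mult[symmetric] q_def tgrid_def mult_ac)
  also have "\<dots> \<le> exp (4 * C * L * T)"
    using tgrid_in_interval[OF T n] C L0 by (simp add: mult_left_mono)
  finally have "4 * ((1 + q) ^ n * B) \<le> 4 * (exp (4 * C * L * T) * B)"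
    using order_trans[OF norm_ge_zero B_ge[of 0]] by (intro mult_left_mono mult_right_mono) auto
  moreover have "norm (r n j - s n j) \<le> 4 * ((1 + q) ^ n * B)" if "j \<le> Nx" for j
    by (intro norm_le_4_times_component growth n that)
  ultimately have "\<forall>j\<le>Nx. norm (r n j - s n j) \<le> 4 * exp (4 * C * L * T) * B"
    by (force simp: mult.assoc)
  then show ?thesis
    unfolding B_def[symmetric] by (subst grid_max_norm_def) auto
qed


section \<open>Consistency\<close>

text \<open>The equation is postulated for interior \<open>x\<close> and positive \<open>t\<close>,
  while the scheme also samples \<open>t = 0\<close> and the endpoints of [0, 1]. It extends there
  because its terms are continuous and the open rectangle is dense in the closed one.\<close>

lemma pde_R_closed_rectangle:
  assumes T: "T > 0" and f: "continuous_on {0..1} fR" "continuous_on {0..1} fI"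
    and r: "continuous_on ({0..T} \<times> {0..1}) (\<lambda>(t, x). r t x)"
    and rt: "continuous_on ({0..T} \<times> {0..1}) (\<lambda>(t, x). rt t x)"
    and rx: "continuous_on ({0..T} \<times> {0..1}) (\<lambda>(t, x). rx t x)"
    and der_t: "\<And>t x. t \<in> {0..T} \<Longrightarrow> x \<in> {0..1} \<Longrightarrow>
      ((\<lambda>s. r s x) has_vector_derivative rt t x) (at t within {0..T})"
    and der_x: "\<And>t x. t \<in> {0..T} \<Longrightarrow> x \<in> {0..1} \<Longrightarrow>
      (r t has_vector_derivative rx t x) (at x within {0..1})"
    and pde: "pde_R T k lam fR fI r"
  defines "G \<equiv> \<lambda>t x. rx t x - Mmat k *v r t x - Phi fR fI x"
  shows "continuous_on ({0..T} \<times> {0..1}) (\<lambda>(t, x). G t x)"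
    and "\<And>t x i. t \<in> {0..T} \<Longrightarrow> x \<in> {0..1} \<Longrightarrow> rt t x $ i + lam $ i * G t x $ i = 0"
proof -
  let ?R = "{0..T} \<times> {0..1::real}"
  have "continuous_on ?R (\<lambda>p. Phi fR fI (snd p))"
    by (rule continuous_on_compose2[OF continuous_on_Phi[OF f]]) (auto intro: continuous_intros)
  then show contG: "continuous_on ?R (\<lambda>(t, x). G t x)"
    using rx bounded_linear.continuous_on[OF matrix_vector_mul_bounded_linear[of "Mmat k"] r]
    unfolding G_def case_prod_unfold by (intro continuous_intros)
  fix t x :: real and i
  assume tx: "t \<in> {0..T}" "x \<in> {0..1}"
  let ?H = "\<lambda>p. rt (fst p) (snd p) $ i + lam $ i * G (fst p) (snd p) $ i"
  let ?S = "{0<..<T} \<times> {0<..<1::real}"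
  have closure: "closure ?S = ?R"
    using T by (simp add: closure_Times)
  have "continuous_on ?R ?H"
    using contG rt unfolding case_prod_unfold by (intro continuous_intros)
  moreover have "?H p = 0" if "p \<in> ?S" for p
  proof -
    obtain s y where p: "p = (s, y)" "s \<in> {0<..<T}" "y \<in> {0<..<1}"
      using \<open>p \<in> ?S\<close> by (rule SigmaE)
    then obtain rt' rx' where
      rt': "((\<lambda>s. r s y) has_vector_derivative rt') (at s within {0..T})" and
      rx': "(r s has_vector_derivative rx') (at y)" and
      eq: "rt' + Lam lam *v rx' = (Lam lam ** Mmat k) *v r s y + Lam lam *v Phi fR fI y"
      using pde unfolding pde_R_def by (metis greaterThanAtMost_iff greaterThanLessThan_iff less_imp_le)
    \<comment> \<open>\<open>pde_R\<close> supplies its own derivatives; uniqueness identifies them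
      with the continuous \<open>rt\<close> and \<open>rx\<close>.\<close>
    have "rt' = rt s y"
      using vector_derivative_unique_within_closed_interval[of 0 T s "\<lambda>s. r s y" rt' "rt s y"]
        T p rt' der_t[of s y] by auto
    moreover have "rx' = rx s y"
      using vector_derivative_unique_within_closed_interval[of 0 1 y "r s" rx' "rx s y"]
        p has_vector_derivative_at_within[OF rx'] der_x[of s y] by auto
    ultimately show ?thesis using eq p unfolding Lam_mult_eq_iff G_def by simp
  qed
  ultimately have "?H (t, x) = 0"
    using continuous_constant_on_closure[of ?S ?H 0 "(t, x)"] tx unfolding closure by auto
  then show "rt t x $ i + lam $ i * G t x $ i = 0" by simp
qed

text \<open>The Heine-Cantor theorem with separate bounds in the two variables. The distance in the
  product is at most the sum of the two, hence the halving of \<open>\<delta>\<close>.\<close>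

lemma uniformly_continuous_on_rectangle:
  fixes g :: "real \<Rightarrow> real \<Rightarrow> 'a::metric_space"
  assumes "continuous_on ({a..b} \<times> {c..d}) (\<lambda>(t, x). g t x)" "e > 0"
  obtains \<delta> where "\<delta> > 0"
    and "\<And>t t' x x'. t \<in> {a..b} \<Longrightarrow> t' \<in> {a..b} \<Longrightarrow> x \<in> {c..d} \<Longrightarrow> x' \<in> {c..d} \<Longrightarrow>
      \<bar>t' - t\<bar> < \<delta> \<Longrightarrow> \<bar>x' - x\<bar> < \<delta> \<Longrightarrow> dist (g t' x') (g t x) < e"
proof -
  have "uniformly_continuous_on ({a..b} \<times> {c..d}) (\<lambda>(t, x). g t x)"
    by (intro compact_uniformly_continuous assms compact_Times compact_Icc)
  then obtain \<delta> where \<delta>: "\<delta> > 0" "\<And>p p'. p \<in> {a..b} \<times> {c..d} \<Longrightarrow> p' \<in> {a..b} \<times> {c..d} \<Longrightarrow>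
      dist p' p < \<delta> \<Longrightarrow> dist (case p' of (t, x) \<Rightarrow> g t x) (case p of (t, x) \<Rightarrow> g t x) < e"
    using assms(2) unfolding uniformly_continuous_on_def by metis
  show ?thesis
  proof (rule that[of "\<delta> / 2"])
    fix t t' x x'
    assume *: "t \<in> {a..b}" "t' \<in> {a..b}" "x \<in> {c..d}" "x' \<in> {c..d}"
      "\<bar>t' - t\<bar> < \<delta> / 2" "\<bar>x' - x\<bar> < \<delta> / 2"
    have "dist (t', x') (t, x) \<le> \<bar>t' - t\<bar> + \<bar>x' - x\<bar>"
      using sqrt_sum_squares_le_sum_abs by (simp add: dist_Pair_Pair dist_real_def)
    then show "dist (g t' x') (g t x) < e"
      using \<delta>(2)[of "(t, x)" "(t', x')"] * by simp
  qed (use \<delta> in simp)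
qed

text \<open>The residual splits into the error of the time quotient, \<open>lam $ i\<close> times
  the error of the spatial quotient, and the left-hand side of the equation, which is 0. Uniform
  continuity of \<open>rt\<close> and \<open>G\<close> controls the first two.\<close>

lemma scheme_consistent:
  assumes T: "T > 0"
    and f: "continuous_on {0..1} fR" "continuous_on {0..1} fI"
    and smooth: "C1_rectangle T r"
    and pde: "pde_R T k lam fR fI r"
    and e: "\<epsilon> > 0"
  shows "\<exists>\<delta>>0. \<forall>Nx Nt. Nx > 0 \<longrightarrow> Nt > 0 \<longrightarrow> dt T Nt < \<delta> \<longrightarrow> dx Nx < \<delta> \<longrightarrow>
    (\<forall>n<Nt. \<forall>j i. imposed Nx i j \<longrightarrow>
      \<bar>residual T k lam fR fI Nx Nt (\<lambda>n j. r (tgrid T Nt n) (xgrid Nx j)) n j $ i\<bar> < \<epsilon>)"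
proof -
  from smooth obtain rt rx where
    cont: "continuous_on ({0..T} \<times> {0..1}) (\<lambda>(t, x). r t x)"
      "continuous_on ({0..T} \<times> {0..1}) (\<lambda>(t, x). rt t x)"
      "continuous_on ({0..T} \<times> {0..1}) (\<lambda>(t, x). rx t x)" and
    der_t: "\<And>t x. t \<in> {0..T} \<Longrightarrow> x \<in> {0..1} \<Longrightarrow>
      ((\<lambda>s. r s x) has_vector_derivative rt t x) (at t within {0..T})" and
    der_x: "\<And>t x. t \<in> {0..T} \<Longrightarrow> x \<in> {0..1} \<Longrightarrow>
      (r t has_vector_derivative rx t x) (at x within {0..1})"
    unfolding C1_rectangle_def by blast
  define G where "G = (\<lambda>t x. rx t x - Mmat k *v r t x - Phi fR fI x)"
  have rect: "continuous_on ({0..T} \<times> {0..1}) (\<lambda>(t, x). G t x)"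
    "\<And>t x i. t \<in> {0..T} \<Longrightarrow> x \<in> {0..1} \<Longrightarrow> rt t x $ i + lam $ i * G t x $ i = 0"
    unfolding G_def by (rule pde_R_closed_rectangle[OF T f cont der_t der_x pde]; assumption)+
  have "bounded ((\<lambda>(t, x). G t x) ` ({0..T} \<times> {0..1}))"
    by (intro compact_imp_bounded compact_continuous_image rect(1) compact_Times compact_Icc)
  then obtain B where B: "\<And>t x. t \<in> {0..T} \<Longrightarrow> x \<in> {0..1} \<Longrightarrow> norm (G t x) \<le> B"
    unfolding bounded_iff by fast
  have B0: "B \<ge> 0" using order_trans[OF norm_ge_zero B[of 0 0]] T by simp
  obtain C where C: "C \<ge> 0" "\<And>h v. \<bar>h\<bar> \<le> 1 \<Longrightarrow>
      norm (matrix_exp (h *\<^sub>R Mmat k) *v v - v) \<le> C * \<bar>h\<bar> * norm v"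
    using matrix_exp_near_identity[of "Mmat k"] by metis
  \<comment> \<open>Chosen so that the spatial error \<open>norm lam * (2 * e2)\<close> is at most
    \<open>\<epsilon> / 2\<close>; the added 1 keeps the denominator positive.\<close>
  define e2 where "e2 = \<epsilon> / (4 * (norm lam + 1))"
  have e2: "e2 > 0" unfolding e2_def using e by (simp add: add_nonneg_pos)
  obtain \<delta>1 where \<delta>1: "\<delta>1 > 0"
    "\<And>t t' x x'. t \<in> {0..T} \<Longrightarrow> t' \<in> {0..T} \<Longrightarrow> x \<in> {0..1} \<Longrightarrow> x' \<in> {0..1} \<Longrightarrow>
      \<bar>t' - t\<bar> < \<delta>1 \<Longrightarrow> \<bar>x' - x\<bar> < \<delta>1 \<Longrightarrow> dist (rt t' x') (rt t x) < \<epsilon> / 4"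
    using uniformly_continuous_on_rectangle[OF cont(2), of "\<epsilon> / 4"] e by auto
  obtain \<delta>2 where \<delta>2: "\<delta>2 > 0"
    "\<And>t t' x x'. t \<in> {0..T} \<Longrightarrow> t' \<in> {0..T} \<Longrightarrow> x \<in> {0..1} \<Longrightarrow> x' \<in> {0..1} \<Longrightarrow>
      \<bar>t' - t\<bar> < \<delta>2 \<Longrightarrow> \<bar>x' - x\<bar> < \<delta>2 \<Longrightarrow> dist (G t' x') (G t x) < e2"
    using uniformly_continuous_on_rectangle[OF rect(1) e2] by auto
  \<comment> \<open>The third bound gives \<open>C * dx Nx * B \<le> e2\<close>, which controls
    exp(hM) - I acting on \<open>G\<close>.\<close>
  define \<delta> where "\<delta> = min (min \<delta>1 \<delta>2) (e2 / (C * B + 1))"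
  have "\<delta> > 0" using \<delta>1 \<delta>2 e2 C B0 by (simp add: \<delta>_def add_nonneg_pos)
  moreover have "\<bar>residual T k lam fR fI Nx Nt (\<lambda>n j. r (tgrid T Nt n) (xgrid Nx j)) n j $ i\<bar> < \<epsilon>"
    if N: "Nx > 0" "Nt > 0" and small: "dt T Nt < \<delta>" "dx Nx < \<delta>"
      and n: "n < Nt" and imp: "imposed Nx i j" for Nx Nt n j i
  proof -
    define t t' a b where "t = tgrid T Nt n" "t' = tgrid T Nt (n + 1)"
      "a = xgrid Nx (upwind i j)" "b = xgrid Nx j"
    note defs = this
    have t: "t \<in> {0..T}" "t' \<in> {0..T}"
      unfolding defs using T n by (intro tgrid_in_interval; simp)+
    have ab: "a \<in> {0..1}" "b \<in> {0..1}"
      unfolding defs using imposed_upwind[OF imp] by (intro xgrid_in_unit; simp)+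
    have t_diff: "t' - t = dt T Nt" by (simp add: defs tgrid_def algebra_simps)
    have x_diff: "\<bar>b - a\<bar> = dx Nx"
      using xgrid_upwind[OF imp] dx_pos[OF N(1)] by (simp add: defs)
    note pos = dt_pos[OF T N(2)] dx_pos[OF N(1)]
    have dx1: "dx Nx \<le> 1" using N by (simp add: dx_def)

    \<comment> \<open>Linearization at \<open>t\<close>: over one time step \<open>rt\<close> varies
      by at most \<open>\<epsilon> / 4\<close>.\<close>
    have "norm (r t' b - r t b - (t' - t) *\<^sub>R rt t b) \<le> norm (t' - t) * (\<epsilon> / 4)"
    proof (rule vector_differentiable_bound_linearization[where S = "{t..t'}"
          and f' = "\<lambda>s. rt s b" and ?x0.0 = t])
      have sub: "{t..t'} \<subseteq> {0..T}" using t by auto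
      show "((\<lambda>s. r s b) has_vector_derivative rt s b) (at s within {t..t'})" if "s \<in> {t..t'}" for s
        using der_t[of s b] ab that sub by (blast intro: has_vector_derivative_within_subset)
      show "norm (rt s b - rt t b) \<le> \<epsilon> / 4" if "s \<in> {t..t'}" for s
        using \<delta>1(2)[of t s b b] t ab that small t_diff pos \<delta>1(1)
        by (auto simp: \<delta>_def dist_norm intro!: less_imp_le)
    qed (use t_diff pos in \<open>auto simp: closed_segment_eq_real_ivl\<close>)
    then have "norm ((1 / dt T Nt) *\<^sub>R (r t' b - r t b - dt T Nt *\<^sub>R rt t b)) \<le> \<epsilon> / 4"
      unfolding norm_scaleR using pos t_diff by (simp add: field_simps)
    then have "\<bar>((1 / dt T Nt) *\<^sub>R (r t' b - r t b - dt T Nt *\<^sub>R rt t b)) $ i\<bar> \<le> \<epsilon> / 4"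
      using component_le_norm_cart order_trans by blast
    then have time: "\<bar>(r t' b $ i - r t b $ i) / dt T Nt - rt t b $ i\<bar> \<le> \<epsilon> / 4"
      using pos by (simp add: field_simps)

    let ?W = "r t b - transport k fR fI a b (r t a)"
    \<comment> \<open>One \<open>e2\<close> accounts for the exponential differing from the
      identity, the other for the variation of \<open>G\<close> between \<open>x\<close> and
      \<open>b\<close>.\<close>
    have "norm (?W - (b - a) *\<^sub>R G t b) \<le> (2 * e2) * \<bar>b - a\<bar>"
    proof (rule transport_defect[OF f _ ab])
      show "(r t has_vector_derivative Mmat k *v r t x + Phi fR fI x + G t x) (at x within {0..1})"
        if "x \<in> {0..1}" for x
        using der_x[OF t(1) that] by (simp add: G_def)
      fix x assume "x \<in> closed_segment a b"
      then have x: "x \<in> {0..1}" "\<bar>b - x\<bar> \<le> dx Nx"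
        using ab x_diff by (auto simp: closed_segment_eq_real_ivl split: if_splits)
      have "norm (matrix_exp ((b - x) *\<^sub>R Mmat k) *v G t x - G t x) \<le> C * \<bar>b - x\<bar> * norm (G t x)"
        using C(2) x dx1 by simp
      also have "\<dots> \<le> C * (e2 / (C * B + 1)) * B"
        using x small C B[OF t(1) x(1)] e2 B0
        by (intro mult_mono mult_left_mono) (auto simp: \<delta>_def add_nonneg_nonneg)
      also have "\<dots> \<le> e2"
        using C B0 e2 add_nonneg_pos[of "C * B" 1] by (simp add: field_simps)
      finally have "norm (matrix_exp ((b - x) *\<^sub>R Mmat k) *v G t x - G t x) \<le> e2" .
      moreover have "norm (G t x - G t b) \<le> e2"
        using \<delta>2(2)[of t t b x] t ab x small \<delta>2(1) abs_minus_commute[of b x]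
        by (auto simp: \<delta>_def dist_norm intro!: less_imp_le)
      ultimately show "norm (matrix_exp ((b - x) *\<^sub>R Mmat k) *v G t x - G t b) \<le> 2 * e2"
        using norm_triangle_ineq[of "matrix_exp ((b - x) *\<^sub>R Mmat k) *v G t x - G t x" "G t x - G t b"]
        by simp
    qed
    then have "\<bar>(?W - (b - a) *\<^sub>R G t b) $ i\<bar> \<le> (2 * e2) * \<bar>b - a\<bar>"
      using component_le_norm_cart order_trans by blast
    then have "\<bar>(?W - (b - a) *\<^sub>R G t b) $ i / (b - a)\<bar> \<le> 2 * e2"
      using x_diff pos by (simp add: abs_divide field_simps)
    moreover have "(?W - (b - a) *\<^sub>R G t b) $ i / (b - a) = ?W $ i / (b - a) - G t b $ i"
      using x_diff pos by (auto simp: field_simps)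
    ultimately have "\<bar>?W $ i / (b - a) - G t b $ i\<bar> \<le> 2 * e2" by (simp only:)
    then have "\<bar>lam $ i\<bar> * \<bar>?W $ i / (b - a) - G t b $ i\<bar> \<le> norm lam * (2 * e2)"
      by (intro mult_mono component_le_norm_cart) auto
    also have "\<dots> \<le> \<epsilon> / 2"
      using e add_nonneg_pos[OF norm_ge_zero, of 1 lam] by (simp add: e2_def field_simps)
    finally have space: "\<bar>lam $ i * (?W $ i / (b - a) - G t b $ i)\<bar> \<le> \<epsilon> / 2"
      by (simp add: abs_mult)

    \<comment> \<open>The three summands are bounded by \<open>\<epsilon> / 4\<close>,
      \<open>\<epsilon> / 2\<close> and 0, together less than \<open>\<epsilon>\<close>.\<close>
    have "residual T k lam fR fI Nx Nt (\<lambda>n j. r (tgrid T Nt n) (xgrid Nx j)) n j $ i =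
        ((r t' b $ i - r t b $ i) / dt T Nt - rt t b $ i) + lam $ i * (?W $ i / (b - a) - G t b $ i)
        + (rt t b $ i + lam $ i * G t b $ i)"
      unfolding residual_upwind[OF imp] defs by (simp add: right_diff_distrib)
    then show ?thesis using rect(2)[OF t(1) ab(2), of i] time space e by linarith
  qed
  ultimately show ?thesis by blast
qed

section \<open>Steady states, stability and consistency combined\<close>

theorem theorem3p1:
  fixes k T :: real and lam :: "real^4"
  assumes "k > 0" and "T > 0"
    and "lam $ 1 > 0" and "lam $ 2 > 0" and "lam $ 3 < 0" and "lam $ 4 < 0"
  shows
    "(\<forall>fR fI g0R g0I g1R g1I rs r_init Nx Nt r n.
        C1_unit_interval fR \<longrightarrow> C1_unit_interval fI \<longrightarrow>
        steady_state_R T k lam fR fI g0R g0I g1R g1I rs \<longrightarrow>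
        Nx > 0 \<longrightarrow> Nt > 0 \<longrightarrow>
        scheme_S T k lam fR fI g0R g0I g1R g1I r_init Nx Nt r \<longrightarrow>
        n < Nt \<longrightarrow> (\<forall>j\<le>Nx. r n j = rs (xgrid Nx j)) \<longrightarrow>
        (\<forall>j\<le>Nx. r (n + 1) j = r n j))
     \<and>
     (\<exists>C. \<forall>fR fI g0R g0I g1R g1I Nx Nt r s.
        C1_unit_interval fR \<longrightarrow> C1_unit_interval fI \<longrightarrow>
        Nx > 0 \<longrightarrow> Nt > 0 \<longrightarrow> CFL T lam Nx Nt \<longrightarrow>
        difference_equations T k lam fR fI Nx Nt r \<longrightarrow>
        grid_boundary_conditions g0R g0I g1R g1I Nx Nt r \<longrightarrow>
        difference_equations T k lam fR fI Nx Nt s \<longrightarrow>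
        grid_boundary_conditions g0R g0I g1R g1I Nx Nt s \<longrightarrow>
        (\<forall>n\<le>Nt. grid_max_norm Nx (\<lambda>j. r n j - s n j)
                  \<le> C * grid_max_norm Nx (\<lambda>j. r 0 j - s 0 j)))
     \<and>
     (\<forall>fR fI g0R g0I g1R g1I r0 r.
        C1_unit_interval fR \<longrightarrow> C1_unit_interval fI \<longrightarrow>
        C1_rectangle T r \<longrightarrow>
        solves_R T k lam fR fI g0R g0I g1R g1I r0 r \<longrightarrow>
        (\<forall>\<epsilon>>0. \<exists>\<delta>>0. \<forall>Nx Nt.
           Nx > 0 \<longrightarrow> Nt > 0 \<longrightarrow> dt T Nt < \<delta> \<longrightarrow> dx Nx < \<delta> \<longrightarrow>
           (\<forall>n<Nt. \<forall>j i. imposed Nx i j \<longrightarrow>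
              \<bar>residual T k lam fR fI Nx Nt
                 (\<lambda>n j. r (tgrid T Nt n) (xgrid Nx j)) n j $ i\<bar> < \<epsilon>)))"
proof (intro conjI)
  have lam_nz: "lam $ i \<noteq> 0" for i using exhaust_4[of i] assms by auto
  show "\<forall>fR fI g0R g0I g1R g1I rs r_init Nx Nt r n.
        C1_unit_interval fR \<longrightarrow> C1_unit_interval fI \<longrightarrow>
        steady_state_R T k lam fR fI g0R g0I g1R g1I rs \<longrightarrow>
        Nx > 0 \<longrightarrow> Nt > 0 \<longrightarrow>
        scheme_S T k lam fR fI g0R g0I g1R g1I r_init Nx Nt r \<longrightarrow>
        n < Nt \<longrightarrow> (\<forall>j\<le>Nx. r n j = rs (xgrid Nx j)) \<longrightarrow>
        (\<forall>j\<le>Nx. r (n + 1) j = r n j)"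
    unfolding scheme_S_def
    using scheme_preserves_steady_state[OF \<open>T > 0\<close> lam_nz] C1_unit_interval_continuous by blast
next
  let ?L = "Max {lam $ 1, lam $ 2, \<bar>lam $ 3\<bar>, \<bar>lam $ 4\<bar>}"
  have L: "\<bar>lam $ i\<bar> \<le> ?L" for i
    using exhaust_4[of i] assms by (auto simp: le_max_iff_disj)
  \<comment> \<open>\<open>C\<close> is fixed before grid and data are quantified and depends only
    on \<open>k\<close>, so the stability constant built from it depends only on \<open>k\<close>,
    \<open>lam\<close> and \<open>T\<close>.\<close>
  obtain C where C: "C \<ge> 0" "\<And>h v. \<bar>h\<bar> \<le> 1 \<Longrightarrow>
      norm (matrix_exp (h *\<^sub>R Mmat k) *v v - v) \<le> C * \<bar>h\<bar> * norm v"
    using matrix_exp_near_identity[of "Mmat k"] by metis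
  show "\<exists>C. \<forall>fR fI g0R g0I g1R g1I Nx Nt r s.
        C1_unit_interval fR \<longrightarrow> C1_unit_interval fI \<longrightarrow>
        Nx > 0 \<longrightarrow> Nt > 0 \<longrightarrow> CFL T lam Nx Nt \<longrightarrow>
        difference_equations T k lam fR fI Nx Nt r \<longrightarrow>
        grid_boundary_conditions g0R g0I g1R g1I Nx Nt r \<longrightarrow>
        difference_equations T k lam fR fI Nx Nt s \<longrightarrow>
        grid_boundary_conditions g0R g0I g1R g1I Nx Nt s \<longrightarrow>
        (\<forall>n\<le>Nt. grid_max_norm Nx (\<lambda>j. r n j - s n j)
                  \<le> C * grid_max_norm Nx (\<lambda>j. r 0 j - s 0 j))"
    unfolding CFL_def
    by (rule exI[of _ "4 * exp (4 * C * ?L * T)"])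
       (intro allI impI scheme_stable[OF \<open>T > 0\<close> _ _ assms(3-6) L _ C])
next
  show "\<forall>fR fI g0R g0I g1R g1I r0 r.
        C1_unit_interval fR \<longrightarrow> C1_unit_interval fI \<longrightarrow>
        C1_rectangle T r \<longrightarrow>
        solves_R T k lam fR fI g0R g0I g1R g1I r0 r \<longrightarrow>
        (\<forall>\<epsilon>>0. \<exists>\<delta>>0. \<forall>Nx Nt.
           Nx > 0 \<longrightarrow> Nt > 0 \<longrightarrow> dt T Nt < \<delta> \<longrightarrow> dx Nx < \<delta> \<longrightarrow>
           (\<forall>n<Nt. \<forall>j i. imposed Nx i j \<longrightarrow>
              \<bar>residual T k lam fR fI Nx Nt
                 (\<lambda>n j. r (tgrid T Nt n) (xgrid Nx j)) n j $ i\<bar> < \<epsilon>))"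
    unfolding solves_R_def
    using scheme_consistent[OF \<open>T > 0\<close>] C1_unit_interval_continuous by blast
qed

end
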